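(* The tanh polynomials $\delta_k(x)$ satisfy, for every integer $k\ge0$, the recurrence relation $$(x+1)\,\delta_k(x+1)=(x-k)\,\delta_k(x)+(x-1)\,\delta_{k-2}(x-1),\qquad x\,\delta_0(x)\equiv1.$$ Moreover, $\delta_k(x)$ has degree $k/2-1$ if $k=2j>0$ is even, and $\delta_k(x)\equiv0$ if $k=2j+1$ is odd.
   Context: Let $\theta(n,m)$ be defined for integers $n,m\ge0$ by $\sum_n\theta(n,m)\frac{u^n}{n!}=\frac1{m!}(\operatorname{artanh}u)^m$. For each fixed integer $k\ge0$, $\theta(n,n-k)$, for integers $n\ge k$, is the value at $x=n$ of a unique polynomial in $x$, denoted $\theta(x,x-k)$. The tanh polynomials are $\delta_k(x)=\theta(x,x-k)/x^{\underline{k+1}}$, where $x^{\underline{k+1}}=x(x-1)\cdots(x-k)$ (a rational function $1/x$ for $k=0$). By convention $\delta_{-1}=\delta_{-2}=0$. *)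

theory Defs
  imports
    "HOL-Analysis.Analysis"
    "HOL-Computational_Algebra.Polynomial_Factorial"
begin

definition fps_artanh :: "real fps" where
  "fps_artanh = Abs_fps (\<lambda>n. if odd n then 1 / of_nat n else 0)"

lemma artanh_sums:
  fixes x :: real
  assumes "\<bar>x\<bar> < 1"
  shows "(\<lambda>n. fps_nth fps_artanh n * x ^ n) sums artanh x"
proof -
  have "(\<lambda>n. (- ((- x) ^ n) / of_nat n - - ((- (- x)) ^ n) / of_nat n) / 2)
          sums ((ln (1 + x) - ln (1 + - x)) / 2)"
    by (intro sums_divide sums_diff ln_series') (use assms in auto)
  moreover have "1 + x > 0" "1 - x > 0"
    using assms by auto
  then have "(ln (1 + x) - ln (1 + - x)) / 2 = artanh x"
    by (simp add: artanh_def ln_div)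
  moreover have "(- ((- x) ^ n) / of_nat n - - ((- (- x)) ^ n) / of_nat n) / 2
                   = fps_nth fps_artanh n * x ^ n" for n
    by (cases "even n") (auto simp: fps_artanh_def)
  ultimately show ?thesis
    by simp
qed

definition theta :: "nat \<Rightarrow> nat \<Rightarrow> real" where
  "theta n m = fact n * fps_nth (fps_const (1 / fact m) * fps_artanh ^ m) n"

lemma theta_egf: "Abs_fps (\<lambda>n. theta n m / fact n) = fps_const (1 / fact m) * fps_artanh ^ m"
  by (simp add: fps_eq_iff theta_def)

text \<open>The polynomial written \<open>\<theta>(x, x - k)\<close>; by \<open>theta_poly_ex1\<close> below it is well defined.\<close>

definition theta_poly :: "nat \<Rightarrow> real poly" where
  "theta_poly k = (THE p. \<forall>n\<ge>k. poly p (of_nat n) = theta n (n - k))"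

lemma theta_diag:
  assumes "k \<le> n"
  shows "theta n (n - k) =
    poly ((\<Prod>i<k. [:- of_nat i, 1:]) *
      (\<Sum>j\<le>k. smult (fps_nth ((fps_shift 1 fps_artanh - 1) ^ j) k / fact j)
                    (\<Prod>i<j. [:- of_nat k - of_nat i, 1:]))) (of_nat n)"
proof -
  define f where "f = fps_shift 1 fps_artanh"
  define g where "g = f - 1"
  define N where "N = n - k"
  have n: "n = N + k" using assms by (simp add: N_def)
  have af: "fps_artanh = fps_X * f"
    by (simp add: fps_eq_iff f_def fps_artanh_def)
  have g0: "fps_nth g 0 = 0"
    by (simp add: g_def f_def fps_artanh_def)
  have g: "fps_nth (g ^ j) k = 0" if "j > k" for j
    using startsby_zero_power_prefix[OF g0] that by blast
  have "fps_nth (f ^ N) k = fps_nth ((g + 1) ^ N) k"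
    by (simp add: g_def)
  also have "\<dots> = (\<Sum>j\<le>N. of_nat (N choose j) * fps_nth (g ^ j) k)"
    by (simp add: binomial_ring fps_sum_nth flip: fps_of_nat)
  also have "\<dots> = (\<Sum>j\<le>k + N. of_nat (N choose j) * fps_nth (g ^ j) k)"
    by (intro sum.mono_neutral_left) auto
  also have "\<dots> = (\<Sum>j\<le>k. of_nat (N choose j) * fps_nth (g ^ j) k)"
    by (intro sum.mono_neutral_right) (auto simp: g)
  also have "\<dots> = (\<Sum>j\<le>k. fps_nth (g ^ j) k / fact j * (\<Prod>i<j. of_nat N - of_nat i))"
    by (simp add: binomial_gbinomial gbinomial_prod_rev atLeast0LessThan mult.commute)
  finally have 1: "fps_nth (f ^ N) k = \<dots>" .
  have "fact n / fact N = (\<Prod>i<k. of_nat n - of_nat i :: real)"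
    using binomial_fact[OF assms, where 'a = real]
    by (simp add: binomial_gbinomial gbinomial_prod_rev atLeast0LessThan N_def field_simps)
  moreover have "theta n N = fact n / fact N * fps_nth (f ^ N) k"
    by (simp add: theta_def af power_mult_distrib fps_X_power_mult_nth n)
  moreover have "poly (\<Prod>i<k. [:- of_nat i, 1:]) (of_nat n) = (\<Prod>i<k. of_nat n - of_nat i :: real)"
    by (simp add: poly_prod)
  moreover have "poly (\<Prod>i<j. [:- of_nat k - of_nat i, 1:]) (of_nat n)
      = (\<Prod>i<j. of_nat N - of_nat i :: real)" for j
    unfolding poly_prod by (intro prod.cong refl) (simp add: n)
  ultimately show ?thesis
    unfolding N_def[symmetric] f_def[symmetric] g_def[symmetric]
    by (simp only: poly_mult poly_sum poly_smult 1)
qed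

lemma theta_poly_ex1: "\<exists>!p. \<forall>n\<ge>k. poly p (of_nat n) = theta n (n - k)"
proof (rule ex_ex1I)
  show "\<exists>p. \<forall>n\<ge>k. poly p (of_nat n) = theta n (n - k)"
    by (intro exI allI impI) (rule theta_diag[symmetric])
next
  fix p q
  assume *: "\<forall>n\<ge>k. poly p (of_nat n) = theta n (n - k)"
    "\<forall>n\<ge>k. poly q (of_nat n) = theta n (n - k)"
  show "p = q"
  proof (rule ccontr)
    assume "p \<noteq> q"
    then have "finite {x. poly (p - q) x = 0}"
      by (intro poly_roots_finite) simp
    moreover have "(of_nat :: nat \<Rightarrow> real) ` {k..} \<subseteq> {x. poly (p - q) x = 0}"
      using * by auto
    ultimately have "finite ((of_nat :: nat \<Rightarrow> real) ` {k..})"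
      by (rule finite_subset[rotated])
    then have "finite {k..}"
      by (rule finite_imageD) (simp add: inj_on_def)
    then show False
      by (simp add: infinite_Ici)
  qed
qed

lemma poly_theta_poly: "k \<le> n \<Longrightarrow> poly (theta_poly k) (of_nat n) = theta n (n - k)"
  using theI'[OF theta_poly_ex1[of k]] by (simp add: theta_poly_def)

definition falling_poly :: "nat \<Rightarrow> real poly" where
  "falling_poly k = (\<Prod>i<k. [:- of_nat i, 1:])"

text \<open>Rational functions in \<open>x\<close> are elements of the fraction field of the polynomial ring. The
  convention \<open>\<delta>\<^sub>-\<^sub>1 = \<delta>\<^sub>-\<^sub>2 = 0\<close> is implemented by an integer index; only these two negative
  indices matter.\<close>

definition tanh_poly :: "int \<Rightarrow> real poly fract" where
  "tanh_poly k = (if k < 0 then 0 else Fract (theta_poly (nat k)) (falling_poly (nat k + 1)))"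

abbreviation fract_X :: "real poly fract" where
  "fract_X \<equiv> to_fract [:0, 1:]"

text \<open>\<open>fract_shift c r\<close> is the rational function \<open>r(x + c)\<close>; by \<open>fract_shift_Fract\<close> below it does
  not depend on the chosen representation of \<open>r\<close>.\<close>

definition fract_shift :: "real \<Rightarrow> real poly fract \<Rightarrow> real poly fract" where
  "fract_shift c r = (THE s. \<exists>p q. q \<noteq> 0 \<and> r = Fract p q \<and>
     s = Fract (p \<circ>\<^sub>p [:c, 1:]) (q \<circ>\<^sub>p [:c, 1:]))"

lemma fract_shift_Fract:
  assumes q: "q \<noteq> 0"
  shows "fract_shift c (Fract p q) = Fract (p \<circ>\<^sub>p [:c, 1:]) (q \<circ>\<^sub>p [:c, 1:])"
  unfolding fract_shift_def
proof (rule the_equality)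
  show "\<exists>a b. b \<noteq> 0 \<and> Fract p q = Fract a b \<and>
      Fract (p \<circ>\<^sub>p [:c, 1:]) (q \<circ>\<^sub>p [:c, 1:]) = Fract (a \<circ>\<^sub>p [:c, 1:]) (b \<circ>\<^sub>p [:c, 1:])"
    using q by blast
next
  fix s
  assume "\<exists>a b. b \<noteq> 0 \<and> Fract p q = Fract a b \<and>
      s = Fract (a \<circ>\<^sub>p [:c, 1:]) (b \<circ>\<^sub>p [:c, 1:])"
  then obtain a b where b: "b \<noteq> 0" and eq: "Fract p q = Fract a b"
    and s: "s = Fract (a \<circ>\<^sub>p [:c, 1:]) (b \<circ>\<^sub>p [:c, 1:])"
    by blast
  from eq have "a * q = p * b"
    using q b by (simp add: eq_fract)
  then have "(a \<circ>\<^sub>p [:c, 1:]) * (q \<circ>\<^sub>p [:c, 1:]) = (p \<circ>\<^sub>p [:c, 1:]) * (b \<circ>\<^sub>p [:c, 1:])"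
    by (metis pcompose_mult)
  then show "s = Fract (p \<circ>\<^sub>p [:c, 1:]) (q \<circ>\<^sub>p [:c, 1:])"
    using q b s by (simp add: eq_fract pcompose_eq_0_iff)
qed

end

theory Submission
  imports Defs
begin

text \<open>
  Write \<open>T\<^sub>m = (artanh u)\<^sup>m / m!\<close>. Since \<open>(1 - u\<^sup>2) artanh' u = 1\<close>, these series satisfy
  \<open>(1 - u\<^sup>2) T\<^sub>m\<^sub>+\<^sub>1' = T\<^sub>m\<close>, and comparing coefficients gives the triangular recurrence \<open>theta_rec\<close>.
  Along the diagonals \<open>m = n - k\<close> it reads
  \<open>P\<^sub>k(x + 1) - P\<^sub>k(x) = x (x - 1) P\<^sub>k\<^sub>-\<^sub>2(x - 1)\<close> for the polynomials \<open>P\<^sub>k(x) = \<theta>(x, x - k)\<close>: the two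
  sides agree at all large integers, hence identically (\<open>theta_poly_difference\<close>). Dividing this
  difference equation by \<open>x (x - 1) \<cdots> (x - k + 1)\<close>, a factor that the denominators of
  \<open>\<delta>\<^sub>k(x + 1)\<close>, \<open>\<delta>\<^sub>k(x)\<close> and \<open>\<delta>\<^sub>k\<^sub>-\<^sub>2(x - 1)\<close> share up to one linear factor each, is the claimed
  recurrence.

  The difference equation also determines the degrees, by induction on \<open>k\<close> in steps of two. If \<open>k\<close>
  is odd, its right-hand side vanishes, so \<open>P\<^sub>k\<close> is constant; the constant is
  \<open>P\<^sub>k(k) = \<theta>(k, 0) = 0\<close>. If \<open>k = 2j\<close>, each step adds two to the degree through the factor
  \<open>x (x - 1)\<close> and one more by summation, so \<open>P\<^sub>2\<^sub>j\<close> has degree \<open>3j\<close>. For \<open>k > 0\<close> the denominator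
  \<open>x (x - 1) \<cdots> (x - k)\<close> of \<open>\<delta>\<^sub>k\<close> divides \<open>P\<^sub>k\<close> (\<open>falling_poly_dvd_theta_poly\<close>), and the quotient has
  degree \<open>3j - (2j + 1) = j - 1\<close>.
\<close>

section \<open>The array \<open>\<theta>(n, m)\<close>\<close>

lemma fps_deriv_artanh: "(1 - fps_X ^ 2) * fps_deriv fps_artanh = 1"
proof (rule fps_ext)
  fix n
  show "fps_nth ((1 - fps_X ^ 2) * fps_deriv fps_artanh) n = fps_nth 1 n"
  proof (cases "n < 2")
    case True
    then have "n = 0 \<or> n = 1" by auto
    then show ?thesis
      by (auto simp: left_diff_distrib fps_X_power_mult_nth fps_artanh_def)
  next
    case False
    then obtain l where "n = Suc (Suc l)"
      by (metis add_2_eq_Suc le_Suc_ex not_less)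
    then show ?thesis
      by (simp add: left_diff_distrib fps_X_power_mult_nth fps_artanh_def)
  qed
qed

text \<open>
  This is the differential equation \<open>(1 - u\<^sup>2) T\<^sub>m\<^sub>+\<^sub>1' = T\<^sub>m\<close> read off at \<open>u\<^sup>n / n!\<close>; the term with
  \<open>u\<^sup>2\<close> contributes the factor \<open>n! / (n - 2)!\<close>. The recurrence holds at \<open>n = 0\<close> too, where \<open>n - 1\<close> truncates, because the factor
  \<open>n (n - 1)\<close> vanishes there.
\<close>

lemma theta_rec:
  "theta (Suc n) (Suc m) = theta n m + of_nat n * (of_nat n - 1) * theta (n - 1) (Suc m)"
proof -
  define T where "T = (\<lambda>m. fps_const (1 / fact m) * fps_artanh ^ m)"
  have nth_T: "fps_nth (T m) n = theta n m / fact n" for m n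
    by (simp add: T_def theta_def)
  have deriv: "fps_deriv (T (Suc m)) = T m * fps_deriv fps_artanh"
  proof -
    have "fps_const (1 / fact (Suc m)) * of_nat (Suc m) = fps_const (1 / fact m :: real)"
      by (simp add: fps_of_nat [symmetric] del: of_nat_Suc)
    moreover have "fps_deriv (T (Suc m)) =
        fps_const (1 / fact (Suc m)) * of_nat (Suc m) * (fps_artanh ^ m * fps_deriv fps_artanh)"
      unfolding T_def fps_deriv_mult fps_deriv_power' by (simp del: of_nat_Suc fact_Suc add: mult_ac)
    ultimately show ?thesis
      by (simp only: T_def mult.assoc)
  qed
  have "fps_deriv (T (Suc m)) - fps_X ^ 2 * fps_deriv (T (Suc m))
      = T m * ((1 - fps_X ^ 2) * fps_deriv fps_artanh)"
    by (simp add: deriv algebra_simps)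
  \<comment> \<open>Both sides at \<open>u\<^sup>n\<close>: differentiation turns \<open>\<theta>(n, m) / n!\<close> into \<open>\<theta>(n + 1, m) / n!\<close>,
    and the factor \<open>u\<^sup>2\<close> then shifts the index by two.\<close>
  then have "fps_nth (fps_deriv (T (Suc m)) - fps_X ^ 2 * fps_deriv (T (Suc m))) n = fps_nth (T m) n"
    by (simp only: fps_deriv_artanh mult_1_right)
  then have *: "theta (Suc n) (Suc m) / fact n
      - (if n < 2 then 0 else of_nat (n - 1) * (theta (n - 1) (Suc m) / fact (n - 1)))
      = theta n m / fact n"
    unfolding fps_sub_nth fps_X_power_mult_nth fps_deriv_nth nth_T
    by (cases "n < 2")
       (auto simp: nth_T Suc_diff_Suc numeral_2_eq_2 fact_Suc simp del: of_nat_Suc)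
  show ?thesis
  proof (cases "n < 2")
    case True
    then have "n = 0 \<or> n = 1" by auto
    with * show ?thesis by auto
  next
    case False
    then have "fact n = of_nat n * (fact (n - 1) :: real)" "of_nat (n - 1) = (of_nat n - 1 :: real)"
      using fact_reduce[of n, where 'a = real] by (auto simp: of_nat_diff)
    with * False show ?thesis
      by (simp add: field_simps)
  qed
qed

lemma theta_eq_0: "n < m \<Longrightarrow> theta n m = 0"
  by (simp add: theta_def startsby_zero_power_prefix fps_artanh_def)

lemma theta_0_right: "k > 0 \<Longrightarrow> theta k 0 = 0"
  by (simp add: theta_def)

section \<open>Polynomials determined by large integers, and finite differences\<close>

lemma poly_eqI_large_nat:
  fixes p q :: "real poly"
  assumes "\<And>n. n \<ge> k \<Longrightarrow> poly p (of_nat n) = poly q (of_nat n)"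
  shows "p = q"
proof (rule ccontr)
  assume "p \<noteq> q"
  then have "finite {x. poly (p - q) x = 0}"
    by (intro poly_roots_finite) simp
  then have "finite ((of_nat :: nat \<Rightarrow> real) ` {k..})"
    by (rule finite_subset[rotated]) (use assms in auto)
  then have "finite {k..}"
    by (rule finite_imageD) (simp add: inj_on_def)
  then show False
    by (simp add: infinite_Ici)
qed

text \<open>
  The forward difference lowers the degree of a nonconstant polynomial by exactly one, because it sends \<open>x\<^sup>d\<^sup>+\<^sup>1\<close> to
  \<open>(d + 1) x\<^sup>d\<close> plus lower terms. Tracking a possibly vanishing coefficient at a degree bound,
  instead of the leading coefficient, is what makes the induction go through: for
  \<open>p = a + x q\<close> and \<open>r(x) = q(x + 1) - q(x)\<close> the difference of \<open>p\<close> is \<open>x r + r + q\<close>.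
\<close>

lemma degree_coeff_difference:
  fixes p :: "real poly"
  assumes "degree p \<le> Suc d"
  shows "degree (p \<circ>\<^sub>p [:1, 1:] - p) \<le> d \<and>
    coeff (p \<circ>\<^sub>p [:1, 1:] - p) d = of_nat (Suc d) * coeff p (Suc d)"
  using assms
proof (induction d arbitrary: p)
  case 0
  obtain a q where p: "p = pCons a q"
    by (cases p)
  have "degree q = 0"
    using 0 by (simp add: p split: if_splits)
  then obtain b where "p = [:a, b:]"
    by (metis p degree_eq_zeroE)
  then show ?case
    by (simp add: pcompose_pCons)
next
  case (Suc d)
  obtain a q where p: "p = pCons a q"
    by (cases p)
  have q: "degree q \<le> Suc d"
    using Suc.prems by (simp add: p split: if_splits)
  define r where "r = q \<circ>\<^sub>p [:1, 1:] - q"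
  have r: "degree r \<le> d" "coeff r d = of_nat (Suc d) * coeff q (Suc d)"
    using Suc.IH[OF q] by (simp_all add: r_def)
  have eq: "p \<circ>\<^sub>p [:1, 1:] - p = pCons 0 r + r + q"
    by (simp add: p r_def pcompose_pCons)
  have "degree (pCons 0 r + r + q) \<le> Suc d"
    using r q by (intro degree_add_le) auto
  moreover have "coeff r (Suc d) = 0"
    using r by (simp add: coeff_eq_0)
  ultimately show ?case
    unfolding eq using r by (simp add: p algebra_simps)
qed

lemma degree_eq_Suc_degree_difference:
  fixes p :: "real poly"
  assumes "p \<circ>\<^sub>p [:1, 1:] - p \<noteq> 0"
  shows "degree p = Suc (degree (p \<circ>\<^sub>p [:1, 1:] - p))"
proof (cases "degree p")
  case 0
  then obtain a where "p = [:a:]"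
    by (rule degree_eq_zeroE)
  with assms show ?thesis by simp
next
  case (Suc d)
  have "coeff p (Suc d) \<noteq> 0"
    using Suc by (metis degree_0 leading_coeff_0_iff nat.distinct(1))
  then have "coeff (p \<circ>\<^sub>p [:1, 1:] - p) d \<noteq> 0"
    using degree_coeff_difference[of p d] Suc by simp
  then show ?thesis
    using degree_coeff_difference[of p d] Suc
    by (metis le_antisym le_degree order_refl)
qed

lemma const_if_difference_eq_0:
  fixes p :: "real poly"
  assumes "p \<circ>\<^sub>p [:1, 1:] = p"
  shows "degree p = 0"
proof (rule ccontr)
  assume "degree p \<noteq> 0"
  then obtain d where d: "degree p = Suc d"
    using not0_implies_Suc by blast
  then have "coeff p (Suc d) = 0"
    using degree_coeff_difference[of p d] assms by simp
  with d show False
    by (metis degree_0 leading_coeff_0_iff nat.distinct(1))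
qed

section \<open>The polynomials \<open>\<theta>(x, x - k)\<close>\<close>

text \<open>
  The right-hand side \<open>x (x - 1) P\<^sub>k\<^sub>-\<^sub>2(x - 1)\<close> of the difference equation, with
  \<open>P\<^sub>-\<^sub>1 = P\<^sub>-\<^sub>2 = 0\<close>.
\<close>

definition theta_poly_step :: "nat \<Rightarrow> real poly" where
  "theta_poly_step k =
    (if k < 2 then 0 else [:0, 1:] * [:- 1, 1:] * (theta_poly (k - 2) \<circ>\<^sub>p [:- 1, 1:]))"

text \<open>
  On the diagonal \<open>m = n - k\<close>, the entry \<open>\<theta>(n - 1, m + 1)\<close> of the triangular recurrence lies on
  diagonal \<open>k - 2\<close>. For \<open>k < 2\<close> that is above the main diagonal, where \<open>\<theta>\<close> vanishes since
  \<open>artanh u\<close> has no constant term; this is the source of the convention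
  \<open>\<delta>\<^sub>-\<^sub>1 = \<delta>\<^sub>-\<^sub>2 = 0\<close>.
\<close>

lemma theta_poly_difference: "theta_poly k \<circ>\<^sub>p [:1, 1:] - theta_poly k = theta_poly_step k"
proof (rule poly_eqI_large_nat[of "Suc k"])
  fix n assume n: "n \<ge> Suc k"
  define m where "m = n - k"
  have "poly (theta_poly k) (1 + of_nat n) = theta (Suc n) (Suc m)"
    using poly_theta_poly[of k "Suc n"] n by (simp add: m_def Suc_diff_le)
  moreover have "poly (theta_poly k) (of_nat n) = theta n m"
    using poly_theta_poly[of k n] n by (simp add: m_def)
  moreover have "of_nat n * (of_nat n - 1) * theta (n - 1) (Suc m) = poly (theta_poly_step k) (of_nat n)"
  proof (cases "k < 2")
    case True
    then have "theta (n - 1) (Suc m) = 0"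
      using n by (intro theta_eq_0) (auto simp: m_def)
    then show ?thesis using True by (simp add: theta_poly_step_def)
  next
    case False
    then have "poly (theta_poly (k - 2)) (of_nat (n - 1)) = theta (n - 1) (n - 1 - (k - 2))"
      using n by (intro poly_theta_poly) auto
    moreover have "n - 1 - (k - 2) = Suc m"
      using n False by (auto simp: m_def)
    ultimately show ?thesis
      using False n by (simp add: theta_poly_step_def poly_pcompose of_nat_diff algebra_simps)
  qed
  ultimately show "poly (theta_poly k \<circ>\<^sub>p [:1, 1:] - theta_poly k) (of_nat n)
      = poly (theta_poly_step k) (of_nat n)"
    using theta_rec[of n m] by (simp add: poly_pcompose)
qed

lemma poly_theta_poly_self: "k > 0 \<Longrightarrow> poly (theta_poly k) (of_nat k) = 0"
  using poly_theta_poly[of k k] by (simp add: theta_0_right)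

lemma theta_poly_0: "theta_poly 0 = 1"
proof (rule poly_eqI_large_nat)
  fix n :: nat
  have "theta n n = 1" for n
  proof (induction n)
    case 0
    then show ?case by (simp add: theta_def)
  next
    case (Suc n)
    then show ?case using theta_rec[of n n] by (simp add: theta_eq_0)
  qed
  then show "poly (theta_poly 0) (of_nat n) = poly 1 (of_nat n)"
    using poly_theta_poly[of 0 n] by simp
qed

lemma theta_poly_odd: "theta_poly (2 * j + 1) = 0"
proof (induction j)
  \<comment> \<open>A solution of the homogeneous difference equation is constant, and its value at \<open>k\<close> is
    \<open>\<theta>(k, 0) = 0\<close>.\<close>
  have const: "theta_poly k = 0" if "theta_poly_step k = 0" "k > 0" for k
  proof -
    have "degree (theta_poly k) = 0"
      using theta_poly_difference[of k] that by (intro const_if_difference_eq_0) simp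
    then show ?thesis
      using poly_theta_poly_self[OF \<open>k > 0\<close>] by (auto elim: degree_eq_zeroE)
  qed
  case 0
  show ?case by (rule const) (auto simp: theta_poly_step_def)
  case (Suc j)
  show ?case by (rule const) (use Suc in \<open>auto simp: theta_poly_step_def\<close>)
qed

lemma degree_theta_poly_even: "theta_poly (2 * j) \<noteq> 0 \<and> degree (theta_poly (2 * j)) = 3 * j"
proof (induction j)
  case 0
  show ?case by (simp add: theta_poly_0)
next
  case (Suc j)
  define p where "p = theta_poly (2 * j) \<circ>\<^sub>p [:- 1, 1:]"
  have p: "p \<noteq> 0" "degree p = 3 * j"
    using Suc by (auto simp: p_def pcompose_eq_0_iff degree_pcompose)
  have step: "theta_poly_step (2 * Suc j) = [:0, 1:] * [:- 1, 1:] * p"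
    by (simp add: theta_poly_step_def p_def)
  then have "theta_poly_step (2 * Suc j) \<noteq> 0"
    using p by (simp del: mult_pCons_left mult_pCons_right)
  moreover have "degree (theta_poly_step (2 * Suc j)) = 3 * j + 2"
    unfolding step using p by (subst degree_mult_eq) auto
  ultimately have "degree (theta_poly (2 * Suc j)) = 3 * Suc j"
    using degree_eq_Suc_degree_difference[of "theta_poly (2 * Suc j)"]
    by (simp add: theta_poly_difference)
  then show ?case by auto
qed

section \<open>Falling factorials\<close>

lemma falling_poly_Suc: "falling_poly (Suc k) = falling_poly k * [:- of_nat k, 1:]"
  by (simp add: falling_poly_def del: mult_pCons_right)

lemma falling_poly_Suc_shift:
  "falling_poly (Suc k) = [:0, 1:] * (falling_poly k \<circ>\<^sub>p [:- 1, 1:])"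
  unfolding falling_poly_def prod.lessThan_Suc_shift pcompose_prod
  by (simp add: pcompose_pCons algebra_simps)

lemma falling_poly_Suc_pcompose:
  "falling_poly (Suc k) \<circ>\<^sub>p [:1, 1:] = [:1, 1:] * falling_poly k"
proof -
  have "falling_poly k \<circ>\<^sub>p [:- 1, 1:] \<circ>\<^sub>p [:1, 1:] = falling_poly k"
    by (simp add: pcompose_assoc [symmetric] pcompose_pCons)
  then show ?thesis
    by (simp only: falling_poly_Suc_shift pcompose_mult) (simp add: pcompose_pCons)
qed

lemma falling_poly_nonzero: "falling_poly k \<noteq> 0"
  by (simp add: falling_poly_def)

lemma degree_falling_poly: "degree (falling_poly k) = k"
  by (induction k)
     (simp_all add: falling_poly_Suc degree_mult_eq falling_poly_nonzero
        falling_poly_def[of 0] del: mult_pCons_right)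

text \<open>
  The factors \<open>x, \<dots>, x - k + 1\<close> come from \<open>theta_diag\<close>: \<open>\<theta>(n, n - k)\<close> is \<open>n! / (n - k)!\<close> times
  the coefficient of \<open>u\<^sup>k\<close> in \<open>(artanh u / u)\<^sup>n\<^sup>-\<^sup>k\<close>, and that coefficient is a polynomial in \<open>n\<close>.
  The last factor \<open>x - k\<close> comes from \<open>\<theta>(k, 0) = 0\<close>, which needs \<open>k > 0\<close>.
\<close>

lemma falling_poly_dvd_theta_poly:
  assumes "k > 0"
  shows "falling_poly (Suc k) dvd theta_poly k"
proof -
  obtain q where q: "theta_poly k = falling_poly k * q"
  proof (rule that, rule poly_eqI_large_nat)
    fix n assume "n \<ge> k"
    then show "poly (theta_poly k) (of_nat n) = poly (falling_poly k *
      (\<Sum>j\<le>k. smult (fps_nth ((fps_shift 1 fps_artanh - 1) ^ j) k / fact j)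
                    (\<Prod>i<j. [:- of_nat k - of_nat i, 1:]))) (of_nat n)"
      unfolding falling_poly_def by (simp only: poly_theta_poly theta_diag)
  qed
  have "poly (falling_poly k) (of_nat k) \<noteq> 0"
    by (simp add: falling_poly_def poly_prod)
  then have "poly q (of_nat k) = 0"
    using poly_theta_poly_self[OF assms] by (simp add: q)
  then show ?thesis
    unfolding q falling_poly_Suc by (intro mult_dvd_mono) (simp_all add: poly_eq_0_iff_dvd)
qed

section \<open>The tanh polynomials\<close>

lemma tanh_poly_of_nat: "tanh_poly (int k) = Fract (theta_poly k) (falling_poly (Suc k))"
  by (simp add: tanh_poly_def)

lemma fract_cancel:
  assumes "b \<noteq> 0" "c \<noteq> 0"
  shows "to_fract c * Fract a (c * b) = Fract a b"
  using assms by (simp add: to_fract_def eq_fract mult_ac)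

text \<open>
  The prefactors \<open>x + 1\<close> and \<open>x - k\<close> cancel the first and the last factor of the denominators of
  \<open>\<delta>\<^sub>k(x + 1)\<close> and \<open>\<delta>\<^sub>k(x)\<close>, and expanding the last term by \<open>x\<close>, if \<open>k \<ge> 2\<close>, gives all three terms the denominator
  \<open>x (x - 1) \<cdots> (x - k + 1)\<close>. What remains is the difference equation for the numerators.
\<close>

lemma tanh_poly_recurrence:
  "(fract_X + 1) * fract_shift 1 (tanh_poly (int k)) =
     (fract_X - of_int (int k)) * tanh_poly (int k)
       + (fract_X - 1) * fract_shift (- 1) (tanh_poly (int k - 2))"
proof -
  let ?F = "falling_poly k"
  have F: "?F \<noteq> 0" by (rule falling_poly_nonzero)
  have of_nat_fract: "of_nat n = to_fract [:of_nat n:]" for n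
    by (simp add: to_fract_def of_nat_fract of_nat_poly)
  have one: "fract_X + 1 = to_fract [:1, 1:]"
    by (simp add: to_fract_def One_fract_def one_pCons)
  have X1: "fract_X - 1 = to_fract [:- 1, 1:]"
    by (simp add: to_fract_def One_fract_def one_pCons)
  have Xk: "fract_X - of_int (int k) = to_fract [:- of_nat k, 1:]"
    by (simp add: of_nat_fract) (simp add: to_fract_def)
  have lhs: "(fract_X + 1) * fract_shift 1 (tanh_poly (int k)) = Fract (theta_poly k \<circ>\<^sub>p [:1, 1:]) ?F"
    unfolding one tanh_poly_of_nat fract_shift_Fract[OF falling_poly_nonzero]
      falling_poly_Suc_pcompose
    using F by (intro fract_cancel) auto
  have rhs1: "(fract_X - of_int (int k)) * tanh_poly (int k) = Fract (theta_poly k) ?F"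
    unfolding Xk tanh_poly_of_nat falling_poly_Suc mult.commute[of ?F]
    using F by (intro fract_cancel) auto
  have rhs2: "(fract_X - 1) * fract_shift (- 1) (tanh_poly (int k - 2)) = Fract (theta_poly_step k) ?F"
  proof (cases "k < 2")
    case True
    then have "tanh_poly (int k - 2) = Fract 0 1"
      by (simp add: tanh_poly_def Zero_fract_def)
    then have "fract_shift (- 1) (tanh_poly (int k - 2)) = 0"
      by (simp add: fract_shift_Fract pcompose_1 Zero_fract_def)
    then show ?thesis
      using True F by (simp add: theta_poly_step_def fract_collapse)
  next
    case False
    then obtain l where k: "k = Suc (Suc l)"
      by (metis add_2_eq_Suc le_Suc_ex not_less)
    have "falling_poly (Suc l) \<circ>\<^sub>p [:- 1, 1:] \<noteq> 0"
      using falling_poly_nonzero[of "Suc l"] by (simp add: pcompose_eq_0_iff)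
    moreover have "tanh_poly (int k - 2) = Fract (theta_poly l) (falling_poly (Suc l))"
      using tanh_poly_of_nat[of l] by (simp add: k)
    ultimately show ?thesis
      unfolding X1 falling_poly_Suc_shift[of "Suc l"] k
      by (simp add: fract_shift_Fract falling_poly_nonzero theta_poly_step_def to_fract_def
            eq_fract mult_ac del: mult_pCons_left mult_pCons_right)
  qed
  have "theta_poly k \<circ>\<^sub>p [:1, 1:] = theta_poly k + theta_poly_step k"
    using theta_poly_difference[of k] by (simp add: algebra_simps)
  then show ?thesis
    unfolding lhs rhs1 rhs2 using F by (simp add: eq_fract algebra_simps)
qed

lemma tanh_poly_even:
  assumes "j > 0"
  shows "\<exists>p. tanh_poly (int (2 * j)) = to_fract p \<and> p \<noteq> 0 \<and> degree p = j - 1"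
proof -
  obtain p where p: "theta_poly (2 * j) = falling_poly (Suc (2 * j)) * p"
    using falling_poly_dvd_theta_poly[of "2 * j"] assms by (auto elim: dvdE)
  have "p \<noteq> 0"
    using degree_theta_poly_even[of j] p by auto
  moreover from this have "degree p = j - 1"
    using degree_theta_poly_even[of j]
    by (simp add: p degree_mult_eq falling_poly_nonzero degree_falling_poly)
  moreover have "tanh_poly (int (2 * j)) = to_fract p"
    unfolding tanh_poly_of_nat p
    by (simp add: to_fract_def eq_fract falling_poly_nonzero)
  ultimately show ?thesis by blast
qed

theorem proposition3p4:
  shows "(\<forall>k\<ge>(0::int). (fract_X + 1) * fract_shift 1 (tanh_poly k) =
            (fract_X - of_int k) * tanh_poly k
              + (fract_X - 1) * fract_shift (- 1) (tanh_poly (k - 2)))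
       \<and> fract_X * tanh_poly 0 = 1
       \<and> (\<forall>k>(0::int). even k \<longrightarrow>
            (\<exists>p. tanh_poly k = to_fract p \<and> p \<noteq> 0 \<and> int (degree p) = k div 2 - 1))
       \<and> (\<forall>k>(0::int). odd k \<longrightarrow> tanh_poly k = 0)"
proof (intro conjI allI impI)
  fix k :: int
  assume "k \<ge> 0"
  then show "(fract_X + 1) * fract_shift 1 (tanh_poly k) =
      (fract_X - of_int k) * tanh_poly k + (fract_X - 1) * fract_shift (- 1) (tanh_poly (k - 2))"
    using tanh_poly_recurrence[of "nat k"] by simp
next
  show "fract_X * tanh_poly 0 = 1"
    by (simp add: tanh_poly_def theta_poly_0 falling_poly_def to_fract_def One_fract_def eq_fract)
next
  fix k :: int
  assume k: "k > 0" "even k"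
  define j where "j = nat (k div 2)"
  have j: "k = int (2 * j)" "j > 0"
    using k by (auto simp: j_def)
  show "\<exists>p. tanh_poly k = to_fract p \<and> p \<noteq> 0 \<and> int (degree p) = k div 2 - 1"
    using tanh_poly_even[OF j(2)] j by (auto simp: of_nat_diff)
next
  fix k :: int
  assume k: "k > 0" "odd k"
  then obtain j where "nat k = 2 * j + 1"
    by (metis even_nat_iff less_imp_le oddE)
  then show "tanh_poly k = 0"
    using k theta_poly_odd[of j]
    by (simp add: tanh_poly_def Zero_fract_def eq_fract falling_poly_nonzero)
qed

end
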